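(* The following identities hold for integers $p$, $q$ and $n$: \[\begin{split}\sum_{j=0}^n jF_{pj+q}&=(n+1)\frac{F_pF_{p(n+1)+q-1}-(F_{p-1}-1)F_{p(n+1)+q}}{L_p-1+(-1)^{p-1}}\\ &\quad+\frac{(F_{2p}-2F_p)(F_{p(n+2)+q-1}-F_{p+q-1})}{(F_{2p-1}-2F_{p-1}+1)(F_{2p+1}-2F_{p+1}+1)-(F_{2p}-2F_p)^2}\\ &\quad-\frac{(F_{2p-1}-2F_{p-1}+1)(F_{p(n+2)+q}-F_{p+q})}{(F_{2p-1}-2F_{p-1}+1)(F_{2p+1}-2F_{p+1}+1)-(F_{2p}-2F_p)^2}\end{split}\] and \[\begin{split}\sum_{j=0}^n jL_{pj+q}&=(n+1)\frac{F_pL_{p(n+1)+q-1}-(F_{p-1}-1)L_{p(n+1)+q}}{L_p-1+(-1)^{p-1}}\\ &\quad+\frac{(F_{2p}-2F_p)(L_{p(n+2)+q-1}-L_{p+q-1})}{(F_{2p-1}-2F_{p-1}+1)(F_{2p+1}-2F_{p+1}+1)-(F_{2p}-2F_p)^2}\\ &\quad-\frac{(F_{2p-1}-2F_{p-1}+1)(L_{p(n+2)+q}-L_{p+q})}{(F_{2p-1}-2F_{p-1}+1)(F_{2p+1}-2F_{p+1}+1)-(F_{2p}-2F_p)^2}.\end{split}\]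
   Context: The Fibonacci numbers $F_n$ and Lucas numbers $L_n$ are defined for all integers $n$ by $F_0=0$, $F_1=1$, $F_n=F_{n-1}+F_{n-2}$ for $n\ge 2$; $L_0=2$, $L_1=1$, $L_n=L_{n-1}+L_{n-2}$ for $n\ge 2$; and $F_{-n}=(-1)^{n-1}F_n$, $L_{-n}=(-1)^nL_n$. *)

theory Defs
  imports Complex_Main "HOL-Number_Theory.Fib"
begin

definition fib_int :: "int \<Rightarrow> int" where
  "fib_int n = (if n \<ge> 0 then int (fib (nat n))
                else (-1) ^ (nat (- n) - 1) * int (fib (nat (- n))))"

fun lucas :: "nat \<Rightarrow> nat" where
  "lucas 0 = 2"
| "lucas (Suc 0) = 1"
| "lucas (Suc (Suc n)) = lucas (Suc n) + lucas n"

definition lucas_int :: "int \<Rightarrow> int" where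
  "lucas_int n = (if n \<ge> 0 then int (lucas (nat n))
                  else (-1) ^ nat (- n) * int (lucas (nat (- n))))"

text \<open>
  Summation between arbitrary integer limits \<open>a\<close> and \<open>b\<close>. For \<open>a \<le> b\<close> it is the
  ordinary sum, for \<open>b = a - 1\<close> it is the empty sum, and for \<open>b < a - 1\<close> the usual
  convention \<open>\<Sum>j=a..b. f j = - (\<Sum>j=b+1..a-1. f j)\<close> applies; at most one of the
  two index sets below is nonempty.
\<close>
definition int_sum :: "int \<Rightarrow> int \<Rightarrow> (int \<Rightarrow> int) \<Rightarrow> int" where
  "int_sum a b f = (\<Sum>j\<in>{a..b}. f j) - (\<Sum>j\<in>{b<..<a}. f j)"

lemma int_sum_eq_sum: "a \<le> b + 1 \<Longrightarrow> int_sum a b f = (\<Sum>j=a..b. f j)"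
proof -
  assume "a \<le> b + 1"
  then have "{b<..<a} = {}" by auto
  then show ?thesis by (simp add: int_sum_def)
qed

end

theory Submission
  imports Defs
begin

text \<open>
  Write \<open>F\<close> for the Fibonacci and \<open>L\<close> for the Lucas numbers, and let \<open>G\<close> be any two-sided
  solution of \<open>G m = G (m - 1) + G (m - 2)\<close>. With the matrix
  \<open>A = [[F (p + 1), F p], [F p, F (p - 1)]]\<close>, the \<open>p\<close>-th power of the Fibonacci matrix, the vectors
  \<open>w j = (G (p j + q), G (p j + q - 1))\<close> satisfy \<open>w (j + 1) = A (w j)\<close>. The identity is therefore
  the first component of the arithmetico-geometric sum
  \[ \sum_{j=0}^n j A^j w_0 = (n + 1) (A - I)^{-1} w_{n+1} - (A - I)^{-2} (w_{n+2} - w_1), \]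
  with the inverses written out through adjugates. Multiplied by \<open>det (A - I)\<^sup>2\<close>, the formula is an
  identity over the integers, and it is proved by stepping \<open>n\<close> up and down from \<open>-1\<close>, where the
  sum is empty; the convention for sums with \<open>n < -1\<close> makes the same step valid in both directions
  (lemma \<open>int_sum_linear_recurrence\<close>).

  The first denominator of the theorem is \<open>- det (A - I) = L p - 1 - (-1)^p\<close>, by Cassini's identity
  \<open>det A = (-1)^p\<close> and \<open>tr A = L p\<close>; the second is \<open>det ((A - I)\<^sup>2)\<close>, its square. They are nonzero
  for \<open>p \<noteq> 0\<close>, because \<open>L p\<close> is nonzero for odd \<open>p\<close> and at least \<open>3\<close> for even \<open>p \<noteq> 0\<close>.
\<close>

section \<open>Fibonacci and Lucas numbers at integer indices\<close>

lemma nonneg_or_neg_int_cases: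
  fixes m :: int
  obtains k where "m = int k + 2" | "m = 1" | "m = 0" | k where "m = - 1 - int k"
proof -
  consider "m \<ge> 2" | "m = 1" | "m = 0" | "m \<le> -1" by linarith
  then show ?thesis
  proof cases
    case 1
    then have "m = int (nat (m - 2)) + 2" by simp
    then show ?thesis by (rule that)
  next
    case 4
    then have "m = - 1 - int (nat (- m - 1))" by simp
    then show ?thesis by (rule that)
  qed (use that in blast)+
qed

lemma fib_int_of_nat: "fib_int (int k) = int (fib k)"
  by (simp add: fib_int_def)

lemma fib_int_minus_of_nat: "fib_int (- int k) = (-1) ^ Suc k * int (fib k)"
  by (cases k) (simp_all add: fib_int_def nat_add_distrib)

lemma lucas_int_of_nat: "lucas_int (int k) = int (lucas k)"
  by (simp add: lucas_int_def)

lemma lucas_int_minus_of_nat: "lucas_int (- int k) = (-1) ^ k * int (lucas k)"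
  by (cases k) (simp_all add: lucas_int_def nat_add_distrib)

lemma fib_int_rec: "fib_int m = fib_int (m - 1) + fib_int (m - 2)"
proof (cases m rule: nonneg_or_neg_int_cases)
  case (1 k)
  then show ?thesis
    using fib_int_of_nat[of k] fib_int_of_nat[of "Suc k"] fib_int_of_nat[of "Suc (Suc k)"]
    by (simp add: algebra_simps)
next
  case (4 k)
  show ?thesis
    unfolding 4 using fib_int_minus_of_nat[of "Suc k"] fib_int_minus_of_nat[of "Suc (Suc k)"]
      fib_int_minus_of_nat[of "Suc (Suc (Suc k))"]
    by (simp add: algebra_simps)
qed (simp_all add: fib_int_def)

lemma lucas_int_rec: "lucas_int m = lucas_int (m - 1) + lucas_int (m - 2)"
proof (cases m rule: nonneg_or_neg_int_cases)
  case (1 k)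
  then show ?thesis
    using lucas_int_of_nat[of k] lucas_int_of_nat[of "Suc k"] lucas_int_of_nat[of "Suc (Suc k)"]
    by (simp add: algebra_simps)
next
  case (4 k)
  show ?thesis
    unfolding 4 using lucas_int_minus_of_nat[of "Suc k"] lucas_int_minus_of_nat[of "Suc (Suc k)"]
      lucas_int_minus_of_nat[of "Suc (Suc (Suc k))"]
    by (simp add: algebra_simps)
qed (simp_all add: lucas_int_def numeral_2_eq_2)

text \<open>
  The two-sided sequence \<open>G\<close> is determined by two consecutive values, and the coefficients in this
  dependence are Fibonacci numbers. This is the first row of the \<open>k\<close>-th power of the Fibonacci
  matrix.
\<close>
lemma fib_int_addition:
  fixes G :: "int \<Rightarrow> int"
  assumes rec: "\<And>m. G m = G (m - 1) + G (m - 2)"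
  shows "G (m + k) = fib_int (k + 1) * G m + fib_int k * G (m - 1)"
proof -
  have up: "G (m + 1) = G m + G (m - 1)" for m
    using rec[of "m + 1"] by simp
  show ?thesis
  proof (induction k arbitrary: m rule: int_induct[where k = 0])
    case base
    show ?case by (simp add: fib_int_def)
  next
    case (step1 i)
    have fib: "fib_int (i + 1 + 1) = fib_int (i + 1) + fib_int i"
      using fib_int_rec[of "i + 1 + 1"] by (simp add: add.commute)
    have "G (m + (i + 1)) = G (m + 1 + i)" by (simp add: add_ac)
    also have "\<dots> = fib_int (i + 1) * (G m + G (m - 1)) + fib_int i * G m"
      by (simp add: step1.IH[of "m + 1"] up)
    finally show ?case unfolding fib by (simp add: algebra_simps)
  next
    case (step2 i)
    have "fib_int (i + 1) = fib_int i + fib_int (i - 1)"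
      using fib_int_rec[of "i + 1"] by simp
    with step2.IH[of "m - 1"] rec[of m] show ?case
      by (simp add: algebra_simps)
  qed
qed

lemma fib_int_cassini:
  "fib_int (p + 1) * fib_int (p - 1) - (fib_int p)\<^sup>2 = (if even p then 1 else -1)"
proof (induction p rule: int_induct[where k = 0])
  case base
  show ?case by (simp add: fib_int_def)
next
  case (step1 i)
  then show ?case
    using fib_int_rec[of "i + 2"] fib_int_rec[of "i + 1"]
    by (auto simp: algebra_simps power2_eq_square split: if_splits)
next
  case (step2 i)
  then show ?case
    using fib_int_rec[of i] fib_int_rec[of "i + 1"]
    by (auto simp: algebra_simps power2_eq_square split: if_splits)
qed

lemma lucas_int_eq_fib_int: "lucas_int p = fib_int (p + 1) + fib_int (p - 1)"
proof -
  have "lucas_int p = 2 * fib_int (p + 1) - fib_int p"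
    using fib_int_addition[of lucas_int 0 p] lucas_int_rec by (simp add: lucas_int_def)
  then show ?thesis using fib_int_rec[of "p + 1"] by simp
qed

lemma lucas_pos: "lucas k > 0"
  by (induction k rule: lucas.induct) auto

lemma lucas_ge_3: "lucas (k + 2) \<ge> 3"
  by (induction k rule: lucas.induct) (auto simp: numeral_eq_Suc)

text \<open>The index \<open>0\<close> must be excluded, since \<open>lucas_int 0 = 2 = 1 + 1\<close>.\<close>
lemma lucas_int_neq:
  assumes "p \<noteq> 0"
  shows "lucas_int p \<noteq> 1 + (if even p then 1 else -1)"
proof -
  define k where "k = nat \<bar>p\<bar>"
  have p: "p = int k \<or> p = - int k" and k: "k \<noteq> 0"
    using assms by (auto simp: k_def)
  show ?thesis
  proof (cases "even p")
    case True
    with p have "even k" by auto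
    with k have "k \<ge> 2" by presburger
    then have "lucas k \<ge> 3" using lucas_ge_3[of "k - 2"] by (simp del: lucas.simps add_2_eq_Suc')
    with True p \<open>even k\<close> show ?thesis
      by (auto simp: lucas_int_of_nat lucas_int_minus_of_nat)
  next
    case False
    with p lucas_pos[of k] show ?thesis
      by (auto simp: lucas_int_of_nat lucas_int_minus_of_nat)
  qed
qed

section \<open>Arithmetico-geometric sums of a planar linear recurrence\<close>

lemma int_sum_step: "int_sum 0 (n + 1) f = int_sum 0 n f + f (n + 1)"
proof (cases "n + 1 \<ge> 0")
  case True
  then have "{0..n + 1} = insert (n + 1) {0..n}" "{n<..<0} = {}" "{n + 1<..<0} = {}" by auto
  with True show ?thesis by (simp add: int_sum_def)
next
  case False
  then have "{n<..<0} = insert (n + 1) {n + 1<..<0}" "{0..n} = {}" "{0..n + 1} = {}" by auto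
  with False show ?thesis by (simp add: int_sum_def)
qed

text \<open>
  Here \<open>(x (j + 1), y (j + 1)) = A (x j, y j)\<close> with \<open>A = [[a, b], [c, d]]\<close>, and \<open>D = - det (A - I)\<close>.
  The coefficients of \<open>y\<close> and \<open>x\<close> are, up to sign, the first rows of the adjugates of \<open>A - I\<close> and
  of \<open>(A - I)\<^sup>2\<close>.
\<close>
lemma int_sum_linear_recurrence:
  fixes x y :: "int \<Rightarrow> int"
  assumes x: "\<And>j. x (j + 1) = a * x j + b * y j"
    and y: "\<And>j. y (j + 1) = c * x j + d * y j"
    and D: "D = b * c - (a - 1) * (d - 1)"
  shows "D\<^sup>2 * int_sum 0 n (\<lambda>j. j * x j) =
    (n + 1) * D * (b * y (n + 1) - (d - 1) * x (n + 1))
    + b * (a + d - 2) * (y (n + 2) - y 1)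
    - ((d - 1)\<^sup>2 + b * c) * (x (n + 2) - x 1)"
    (is "_ = ?R n")
proof -
  have step: "?R (n + 1) = ?R n + D\<^sup>2 * ((n + 1) * x (n + 1))" for n
  proof -
    have shift: "n + 1 + 2 = (n + 1 + 1) + 1" "n + 2 = (n + 1) + 1" by simp_all
    show ?thesis
      unfolding shift x y D by algebra
  qed
  show ?thesis
  proof (induction n rule: int_induct[where k = "-1"])
    case base
    show ?case by (simp add: int_sum_eq_sum)
  next
    case (step1 i)
    then show ?case
      unfolding int_sum_step step by (simp add: distrib_left)
  next
    case (step2 i)
    then show ?case
      using step[of "i - 1"] int_sum_step[of "i - 1" "\<lambda>j. j * x j"]
      by (simp add: distrib_left)
  qed
qed

section \<open>The weighted sum formula\<close>

text \<open>
  Both identities of the theorem are instances of this one, since it uses of \<open>G\<close> only the Fibonacci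
  recurrence.
\<close>
lemma weighted_sum_fibonacci_recurrence:
  fixes p q n :: int and G :: "int \<Rightarrow> int"
  assumes "p \<noteq> 0" and rec: "\<And>m. G m = G (m - 1) + G (m - 2)"
  shows
    "real_of_int (int_sum 0 n (\<lambda>j. j * G (p * j + q))) =
       real_of_int (n + 1) *
         (real_of_int (fib_int p * G (p * (n + 1) + q - 1)
                       - (fib_int (p - 1) - 1) * G (p * (n + 1) + q))
          / (real_of_int (lucas_int p) - 1 + (-1) powi (p - 1)))
       + real_of_int ((fib_int (2 * p) - 2 * fib_int p)
                      * (G (p * (n + 2) + q - 1) - G (p + q - 1)))
         / real_of_int ((fib_int (2 * p - 1) - 2 * fib_int (p - 1) + 1)
                        * (fib_int (2 * p + 1) - 2 * fib_int (p + 1) + 1)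
                        - (fib_int (2 * p) - 2 * fib_int p)\<^sup>2)
       - real_of_int ((fib_int (2 * p - 1) - 2 * fib_int (p - 1) + 1)
                      * (G (p * (n + 2) + q) - G (p + q)))
         / real_of_int ((fib_int (2 * p - 1) - 2 * fib_int (p - 1) + 1)
                        * (fib_int (2 * p + 1) - 2 * fib_int (p + 1) + 1)
                        - (fib_int (2 * p) - 2 * fib_int p)\<^sup>2)"
proof -
  define a b d D where
    "a = fib_int (p + 1)" and "b = fib_int p" and "d = fib_int (p - 1)"
    and "D = b * b - (a - 1) * (d - 1)"
  have x: "G (p * (j + 1) + q) = a * G (p * j + q) + b * G (p * j + q - 1)" for j
    using fib_int_addition[of G "p * j + q" p, OF rec]
    by (simp add: a_def b_def algebra_simps)
  have y: "G (p * (j + 1) + q - 1) = b * G (p * j + q) + d * G (p * j + q - 1)" for j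
    using fib_int_addition[of G "p * j + q" "p - 1", OF rec] fib_int_rec[of "p + 1"]
      rec[of "p * j + q"] fib_int_addition[of G "p * j + q - 1" p, OF rec]
    by (simp add: b_def d_def algebra_simps)
  have double: "fib_int (2 * p) - 2 * b = b * (a + d - 2)"
      "fib_int (2 * p - 1) - 2 * d + 1 = (d - 1)\<^sup>2 + b * b"
      "fib_int (2 * p + 1) - 2 * a + 1 = (a - 1)\<^sup>2 + b * b"
    using fib_int_addition[of fib_int p p, OF fib_int_rec]
      fib_int_addition[of fib_int "p - 1" p, OF fib_int_rec]
      fib_int_addition[of fib_int "p + 1" p, OF fib_int_rec]
      fib_int_addition[of fib_int "p" "p - 1", OF fib_int_rec]
    by (simp_all add: a_def b_def d_def algebra_simps power2_eq_square)
  have lucas: "lucas_int p = a + d"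
    by (simp add: lucas_int_eq_fib_int a_def d_def)
  have cassini: "a * d - b\<^sup>2 = (if even p then 1 else -1)"
    unfolding a_def b_def d_def by (rule fib_int_cassini)
  have D: "D = lucas_int p - 1 - (if even p then 1 else -1)"
    unfolding cassini[symmetric] lucas D_def by algebra
  with lucas_int_neq[OF \<open>p \<noteq> 0\<close>] have "D \<noteq> 0" by simp
  have den1: "real_of_int (lucas_int p) - 1 + (-1) powi (p - 1) = real_of_int D"
    by (simp add: D power_int_minus_left)
  have den2: "((d - 1)\<^sup>2 + b * b) * ((a - 1)\<^sup>2 + b * b) - (b * (a + d - 2))\<^sup>2 = D\<^sup>2"
    unfolding D_def by algebra
  have "D\<^sup>2 * int_sum 0 n (\<lambda>j. j * G (p * j + q)) =
      (n + 1) * D * (b * G (p * (n + 1) + q - 1) - (d - 1) * G (p * (n + 1) + q))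
      + b * (a + d - 2) * (G (p * (n + 2) + q - 1) - G (p + q - 1))
      - ((d - 1)\<^sup>2 + b * b) * (G (p * (n + 2) + q) - G (p + q))"
    using int_sum_linear_recurrence[of "\<lambda>j. G (p * j + q)" a b "\<lambda>j. G (p * j + q - 1)" b d D n,
        OF x y D_def] by simp
  \<comment> \<open>With variables for the integer expressions, the division by \<open>D\<^sup>2\<close> does not look inside them.\<close>
  then have int_eq: "S * D\<^sup>2 = (n + 1) * D * U + V - W"
    if "S = int_sum 0 n (\<lambda>j. j * G (p * j + q))"
      and "U = b * G (p * (n + 1) + q - 1) - (d - 1) * G (p * (n + 1) + q)"
      and "V = b * (a + d - 2) * (G (p * (n + 2) + q - 1) - G (p + q - 1))"
      and "W = ((d - 1)\<^sup>2 + b * b) * (G (p * (n + 2) + q) - G (p + q))" for S U V W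
    using that by (simp add: mult.commute)
  have divide: "real_of_int S = real_of_int (n + 1) * (real_of_int U / real_of_int D)
      + real_of_int V / real_of_int (D\<^sup>2) - real_of_int W / real_of_int (D\<^sup>2)"
    if "S * D\<^sup>2 = (n + 1) * D * U + V - W" for S U V W
  proof -
    have "real_of_int S * (real_of_int D)\<^sup>2
        = real_of_int (n + 1) * real_of_int D * real_of_int U + real_of_int V - real_of_int W"
      using arg_cong[OF that, of real_of_int] by simp
    with \<open>D \<noteq> 0\<close> show ?thesis
      by (simp add: divide_simps power2_eq_square)
  qed
  show ?thesis
    unfolding den1 a_def[symmetric] b_def[symmetric] d_def[symmetric] double den2
    by (intro divide int_eq refl)
qed

theorem theorem7:
  fixes p q n :: int
  assumes "p \<noteq> 0"
  shows
    "real_of_int (int_sum 0 n (\<lambda>j. j * fib_int (p * j + q))) =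
       real_of_int (n + 1) *
         (real_of_int (fib_int p * fib_int (p * (n + 1) + q - 1)
                       - (fib_int (p - 1) - 1) * fib_int (p * (n + 1) + q))
          / (real_of_int (lucas_int p) - 1 + (-1) powi (p - 1)))
       + real_of_int ((fib_int (2 * p) - 2 * fib_int p)
                      * (fib_int (p * (n + 2) + q - 1) - fib_int (p + q - 1)))
         / real_of_int ((fib_int (2 * p - 1) - 2 * fib_int (p - 1) + 1)
                        * (fib_int (2 * p + 1) - 2 * fib_int (p + 1) + 1)
                        - (fib_int (2 * p) - 2 * fib_int p)\<^sup>2)
       - real_of_int ((fib_int (2 * p - 1) - 2 * fib_int (p - 1) + 1)
                      * (fib_int (p * (n + 2) + q) - fib_int (p + q)))
         / real_of_int ((fib_int (2 * p - 1) - 2 * fib_int (p - 1) + 1)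
                        * (fib_int (2 * p + 1) - 2 * fib_int (p + 1) + 1)
                        - (fib_int (2 * p) - 2 * fib_int p)\<^sup>2)
     \<and>
     real_of_int (int_sum 0 n (\<lambda>j. j * lucas_int (p * j + q))) =
       real_of_int (n + 1) *
         (real_of_int (fib_int p * lucas_int (p * (n + 1) + q - 1)
                       - (fib_int (p - 1) - 1) * lucas_int (p * (n + 1) + q))
          / (real_of_int (lucas_int p) - 1 + (-1) powi (p - 1)))
       + real_of_int ((fib_int (2 * p) - 2 * fib_int p)
                      * (lucas_int (p * (n + 2) + q - 1) - lucas_int (p + q - 1)))
         / real_of_int ((fib_int (2 * p - 1) - 2 * fib_int (p - 1) + 1)
                        * (fib_int (2 * p + 1) - 2 * fib_int (p + 1) + 1)
                        - (fib_int (2 * p) - 2 * fib_int p)\<^sup>2)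
       - real_of_int ((fib_int (2 * p - 1) - 2 * fib_int (p - 1) + 1)
                      * (lucas_int (p * (n + 2) + q) - lucas_int (p + q)))
         / real_of_int ((fib_int (2 * p - 1) - 2 * fib_int (p - 1) + 1)
                        * (fib_int (2 * p + 1) - 2 * fib_int (p + 1) + 1)
                        - (fib_int (2 * p) - 2 * fib_int p)\<^sup>2)"
  by (intro conjI weighted_sum_fibonacci_recurrence assms fib_int_rec lucas_int_rec)

end
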